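(* Let $\overline{m}$ be an even positive integer, and consider the following two-agent game in which each agent has $m=2\overline{m}$ actions. Agent 1 chooses a row and agent 2 chooses a column, and for $i=1,2$ the utility matrix of agent $i$ is \[ U_i=\begin{bmatrix} U_i^{1,1} & U_i^{1,2}\\ U_i^{2,1} & U_i^{2,2}\end{bmatrix}, \] where the blocks are $\overline{m}\times\overline{m}$ matrices with entries, for $r,s\in\{1,\ldots,\overline{m}\}$ ($r$ the row index and $s$ the column index within the block): \[ U_1^{1,1}(r,s)=\begin{cases}1&\text{if } r+s \text{ is odd}\\ 0&\text{otherwise}\end{cases},\qquad U_1^{2,1}(r,s)=\begin{cases}-\overline{m}&\text{if } r=s\\ 1&\text{otherwise}\end{cases}, \] \[ U_1^{1,2}(r,s)=-\overline{m},\qquad U_1^{2,2}(r,s)=0, \] \[ U_2^{1,1}(r,s)=\begin{cases}1&\text{if } r+s \text{ is even}\\ 0&\text{otherwise}\end{cases},\qquad U_2^{2,1}=U_1^{1,2},\qquad U_2^{1,2}=U_1^{2,1},\qquad U_2^{2,2}=U_1^{2,2}. \] Then this game has a strong Nash equilibrium with support sizes $|S_1|=|S_2|=\overline{m}$, and it has no other strong Nash equilibrium.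
   Context: In a two-agent game, a mixed strategy of agent $i$ is a probability distribution on the agent's actions, agents randomize independently, and utilities extend by expectation. The support $S_i$ is the set of actions agent $i$ plays with positive probability. A strong Nash equilibrium (SNE) is a mixed profile $\mathbf{x}=(\mathbf{x}_1,\mathbf{x}_2)$ such that for no nonempty coalition $C\subseteq\{1,2\}$ are there mixed strategies for the members of $C$ such that, when they play these and the agents outside $C$ keep their strategies in $\mathbf{x}$, every member of $C$ obtains a strictly larger expected utility than in $\mathbf{x}$.
   Formalization: "No other strong Nash equilibrium" is proved as: every strong Nash equilibrium has the same supports (S_1, S_2); literal uniqueness of the mixed profile fails, e.g. for m̄=4 both agents playing (1/4,1/4,1/4,1/4,0,0,0,0) or both playing (3/10,3/10,1/5,1/5,0,0,0,0) are both equilibria. *)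

theory Defs
  imports "HOL-Probability.Probability_Mass_Function"
begin

datatype agent = Agent1 | Agent2

type_synonym 'a profile = "agent \<Rightarrow> 'a pmf"

definition mixed_strategy :: "(agent \<Rightarrow> 'a set) \<Rightarrow> agent \<Rightarrow> 'a pmf \<Rightarrow> bool" where
  "mixed_strategy A i p \<longleftrightarrow> set_pmf p \<subseteq> A i"

(* u i a b is the utility of agent i when Agent1 plays a (the row) and Agent2 plays b (the column). *)
definition expected_utility ::
    "(agent \<Rightarrow> 'a \<Rightarrow> 'a \<Rightarrow> real) \<Rightarrow> 'a profile \<Rightarrow> agent \<Rightarrow> real" where
  "expected_utility u x i =
     measure_pmf.expectation (pair_pmf (x Agent1) (x Agent2)) (\<lambda>(a, b). u i a b)"

(* override_on x y C: the members of C play according to y, all others according to x. *)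
definition strong_Nash_equilibrium ::
    "(agent \<Rightarrow> 'a set) \<Rightarrow> (agent \<Rightarrow> 'a \<Rightarrow> 'a \<Rightarrow> real) \<Rightarrow> 'a profile \<Rightarrow> bool" where
  "strong_Nash_equilibrium A u x \<longleftrightarrow>
     (\<forall>i. mixed_strategy A i (x i)) \<and>
     \<not> (\<exists>C y. C \<noteq> {} \<and> (\<forall>i\<in>C. mixed_strategy A i (y i)) \<and>
          (\<forall>i\<in>C. expected_utility u (override_on x y C) i > expected_utility u x i))"

(* Indices start at 1, also within each block, so that block entries are addressed by r, s \<in> {1..k}. *)
definition block_matrix ::
    "nat \<Rightarrow> (nat \<Rightarrow> nat \<Rightarrow> real) \<Rightarrow> (nat \<Rightarrow> nat \<Rightarrow> real) \<Rightarrow>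
     (nat \<Rightarrow> nat \<Rightarrow> real) \<Rightarrow> (nat \<Rightarrow> nat \<Rightarrow> real) \<Rightarrow> nat \<Rightarrow> nat \<Rightarrow> real" where
  "block_matrix k B11 B12 B21 B22 a b =
     (if a \<le> k
      then (if b \<le> k then B11 a b else B12 a (b - k))
      else (if b \<le> k then B21 (a - k) b else B22 (a - k) (b - k)))"

definition U1_11 :: "nat \<Rightarrow> nat \<Rightarrow> real" where
  "U1_11 r s = (if odd (r + s) then 1 else 0)"

definition U1_21 :: "nat \<Rightarrow> nat \<Rightarrow> nat \<Rightarrow> real" where
  "U1_21 k r s = (if r = s then - real k else 1)"

definition U1_12 :: "nat \<Rightarrow> nat \<Rightarrow> nat \<Rightarrow> real" where
  "U1_12 k r s = - real k"

definition U1_22 :: "nat \<Rightarrow> nat \<Rightarrow> real" where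
  "U1_22 r s = 0"

definition U2_11 :: "nat \<Rightarrow> nat \<Rightarrow> real" where
  "U2_11 r s = (if even (r + s) then 1 else 0)"

fun utility :: "nat \<Rightarrow> agent \<Rightarrow> nat \<Rightarrow> nat \<Rightarrow> real" where
  "utility k Agent1 = block_matrix k U1_11 (U1_12 k) (U1_21 k) U1_22"
| "utility k Agent2 = block_matrix k U2_11 (U1_21 k) (U1_12 k) U1_22"

(* In this game equilibria can be unique only up to their supports: for k = 4, both agents
   playing the weights (1/4, 1/4, 1/4, 1/4, 0, 0, 0, 0), and both agents playing
   (3/10, 3/10, 1/5, 1/5, 0, 0, 0, 0), are two different strong Nash equilibria. *)
definition actions :: "nat \<Rightarrow> agent \<Rightarrow> nat set" where
  "actions k i = {1..2 * k}"

end

theory Submission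
  imports Defs
begin

text \<open>
  The two payoffs never add up to more than 1, with equality only when both agents stay in the first
  block, and every split \<open>(t, 1 - t)\<close> is attained there by two rows against one column. An agent
  with payoff 1 leaves some action of the first block unused, and then the other agent gets at
  least 0 by playing the matching action of the second block. Hence a strong Nash equilibrium has
  total payoff exactly 1 and is supported in the first block. If some action of the first block were
  unused by one agent, the matching action of the second block would now earn the other agent
  payoff 1. The former agent would then get 0, whereas its opponent must use the whole first block
  and so offers a positive payoff. Uniform play on the first block is an equilibrium:
  it gives both agents 1/2, and no reply to it earns more.
\<close>

section \<open>Bounds on finite expectations, and parity counts\<close>

lemma pmf_expectation_less:
  fixes f :: "'a \<Rightarrow> real"
  assumes fin: "finite (set_pmf M)" and le: "\<And>x. x \<in> set_pmf M \<Longrightarrow> f x \<le> c"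
    and x: "x \<in> set_pmf M" "f x < c"
  shows "measure_pmf.expectation M f < c"
proof -
  have "measure_pmf.expectation M f = (\<Sum>a\<in>set_pmf M. f a * pmf M a)"
    using fin by (intro integral_measure_pmf_real) auto
  also have "\<dots> < (\<Sum>a\<in>set_pmf M. c * pmf M a)"
    using x le by (intro sum_strict_mono_ex1[OF fin])
      (auto intro!: mult_right_mono bexI[of _ x] mult_strict_right_mono simp: pmf_positive)
  also have "\<dots> = c"
    using sum_pmf_eq_1[OF fin order_refl] by (simp flip: sum_distrib_left)
  finally show ?thesis .
qed

lemma pmf_expectation_le:
  fixes f :: "'a \<Rightarrow> real"
  assumes fin: "finite (set_pmf M)" and le: "\<And>x. x \<in> set_pmf M \<Longrightarrow> f x \<le> c"
  shows "measure_pmf.expectation M f \<le> c"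
  by (intro measure_pmf.integral_le_const integrable_measure_pmf_finite fin)
    (auto simp: AE_measure_pmf_iff le)

lemma pmf_expectation_ge:
  fixes f :: "'a \<Rightarrow> real"
  assumes fin: "finite (set_pmf M)" and ge: "\<And>x. x \<in> set_pmf M \<Longrightarrow> c \<le> f x"
  shows "c \<le> measure_pmf.expectation M f"
  by (intro measure_pmf.integral_ge_const integrable_measure_pmf_finite fin)
    (auto simp: AE_measure_pmf_iff ge)

text \<open>Consecutive values of \<open>b\<close> give opposite parities, so each such pair
  contributes exactly 1; hence the induction on half of \<open>k\<close>.\<close>

lemma sum_parity:
  fixes k :: nat
  assumes "even k"
  shows "(\<Sum>b=1..k. if odd (a + b) then 1 else 0 :: real) = k / 2"
    and "(\<Sum>b=1..k. if even (a + b) then 1 else 0 :: real) = k / 2"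
proof -
  from assms obtain j where k: "k = 2 * j" ..
  show "(\<Sum>b=1..k. if odd (a + b) then 1 else 0 :: real) = k / 2"
    unfolding k by (induction j) auto
  show "(\<Sum>b=1..k. if even (a + b) then 1 else 0 :: real) = k / 2"
    unfolding k by (induction j) auto
qed

section \<open>The game in a form symmetric in the two agents\<close>

fun opponent :: "agent \<Rightarrow> agent" where
  "opponent Agent1 = Agent2"
| "opponent Agent2 = Agent1"

lemma opponent_opponent [simp]: "opponent (opponent i) = i"
  by (cases i) auto

lemma opponent_neq [simp]: "opponent i \<noteq> i" "i \<noteq> opponent i"
  by (cases i; simp)+

lemma agent_cases_opponent: "j = i \<or> j = opponent i"
  by (cases i; cases j) auto

fun wins :: "agent \<Rightarrow> nat \<Rightarrow> nat \<Rightarrow> bool" where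
  "wins Agent1 a b = odd (a + b)"
| "wins Agent2 a b = even (a + b)"

text \<open>The utility of \<open>i\<close> as a function of its own action \<open>a\<close> and the opponent's action \<open>b\<close>,
  which makes the two agents differ only in \<^const>\<open>wins\<close>.\<close>

definition own_utility :: "nat \<Rightarrow> agent \<Rightarrow> nat \<Rightarrow> nat \<Rightarrow> real" where
  "own_utility k i a b =
     (if a \<le> k then (if b \<le> k then (if wins i a b then 1 else 0) else - real k)
      else (if b \<le> k then (if a - k = b then - real k else 1) else 0))"

text \<open>The off-diagonal blocks of the two agents are swapped, and parity of
  \<open>r + s\<close> and the condition \<open>r = s\<close> are symmetric, so transposing the
  matrix of \<open>Agent2\<close> gives the common form.\<close>

lemma utility_eq_own_utility:
  "utility k Agent1 a b = own_utility k Agent1 a b"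
  "utility k Agent2 a b = own_utility k Agent2 b a"
  by (auto simp: own_utility_def block_matrix_def U1_11_def U1_12_def U1_21_def U1_22_def U2_11_def
      add.commute)

lemma expected_utility_eq:
  "expected_utility (utility k) x i =
     measure_pmf.expectation (pair_pmf (x i) (x (opponent i))) (\<lambda>(a, b). own_utility k i a b)"
proof (cases i)
  case Agent1
  then show ?thesis by (simp add: expected_utility_def utility_eq_own_utility del: utility.simps)
next
  case Agent2
  then show ?thesis
    by (simp add: expected_utility_def utility_eq_own_utility pair_commute_pmf[of "x Agent1"]
        case_prod_unfold del: utility.simps)
qed

lemma wins_one_of_two: "wins i 1 b \<longleftrightarrow> \<not> wins i 2 b" "wins i b 1 \<longleftrightarrow> \<not> wins i b 2"
  by (cases i; simp)+

lemma wins_opponent: "wins (opponent i) b a \<longleftrightarrow> \<not> wins i a b"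
  by (cases i) auto

lemma own_utility_le_1: "own_utility k i a b \<le> 1"
  by (auto simp: own_utility_def)

lemma own_utility_sum_block: "a \<le> k \<Longrightarrow> b \<le> k \<Longrightarrow> own_utility k i a b + own_utility k (opponent i) b a = 1"
  by (auto simp: own_utility_def wins_opponent)

text \<open>One action in each block gives a total of at most \<open>1 - k\<close>; two second-block
  actions give 0.\<close>

lemma own_utility_sum_less:
  "k > 0 \<Longrightarrow> \<not> (a \<le> k \<and> b \<le> k) \<Longrightarrow> own_utility k i a b + own_utility k (opponent i) b a < 1"
  by (auto simp: own_utility_def)

lemma own_utility_sum_le: "k > 0 \<Longrightarrow> own_utility k i a b + own_utility k (opponent i) b a \<le> 1"
  using own_utility_sum_block[of a k b i] own_utility_sum_less[of k a b i] by fastforce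

text \<open>A first-block action wins against exactly half of the block. For a second-block action
  the single entry \<open>- k\<close> cancels all the entries 1.\<close>

lemma own_utility_uniform_le:
  assumes "even k" "k > 0" "a \<in> {1..2 * k}"
  shows "measure_pmf.expectation (pmf_of_set {1..k}) (own_utility k i a) \<le> 1 / 2"
proof -
  have "measure_pmf.expectation (pmf_of_set {1..k}) (own_utility k i a) = (\<Sum>b=1..k. own_utility k i a b) / k"
    using \<open>k > 0\<close> by (subst integral_pmf_of_set) auto
  also have "\<dots> \<le> 1 / 2"
  proof (cases "a \<le> k")
    case True
    then have "(\<Sum>b=1..k. own_utility k i a b) = (\<Sum>b=1..k. if wins i a b then 1 else 0)"
      by (intro sum.cong) (auto simp: own_utility_def)
    also have "\<dots> = k / 2"
      using sum_parity[OF \<open>even k\<close>, of a] by (cases i) simp_all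
    finally show ?thesis using \<open>k > 0\<close> by simp
  next
    case False
    then have a: "a - k \<in> {1..k}" using assms by auto
    have "(\<Sum>b=1..k. own_utility k i a b)
        = own_utility k i a (a - k) + (\<Sum>b\<in>{1..k} - {a - k}. own_utility k i a b)"
      by (rule sum.remove) (use a in auto)
    also have "(\<Sum>b\<in>{1..k} - {a - k}. own_utility k i a b) \<le> (\<Sum>b\<in>{1..k} - {a - k}. 1)"
      by (intro sum_mono own_utility_le_1)
    also have "\<dots> \<le> k" using a by simp
    also have "own_utility k i a (a - k) = - k"
      using False a by (auto simp: own_utility_def)
    finally have "(\<Sum>b=1..k. own_utility k i a b) \<le> 0" by simp
    then show ?thesis by (meson divide_nonpos_nonneg of_nat_0_le_iff order_trans zero_le_divide_1_iff zero_le_numeral)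
  qed
  finally show ?thesis .
qed

section \<open>Payoffs of arbitrary finitely supported profiles\<close>

locale finite_profile =
  fixes k :: nat and x :: "nat profile"
  assumes k_pos: "k > 0" and finite_support [simp]: "finite (set_pmf (x i))"
begin

abbreviation "payoff i \<equiv> expected_utility (utility k) x i"

text \<open>Both payoffs are put over the same product distribution, so that the pointwise bounds on
  the sum of utilities apply.\<close>

lemma payoff_sum:
  "payoff i + payoff (opponent i) = measure_pmf.expectation (pair_pmf (x i) (x (opponent i)))
     (\<lambda>(a, b). own_utility k i a b + own_utility k (opponent i) b a)"
proof -
  have "payoff (opponent i) = measure_pmf.expectation (pair_pmf (x i) (x (opponent i)))
     (\<lambda>(a, b). own_utility k (opponent i) b a)"
    by (simp add: expected_utility_eq pair_commute_pmf[of "x (opponent i)"] case_prod_unfold)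
  then show ?thesis
    by (simp add: expected_utility_eq[of k x i] case_prod_unfold integrable_measure_pmf_finite)
qed

lemma payoff_sum_le: "payoff i + payoff (opponent i) \<le> 1"
  unfolding payoff_sum by (rule pmf_expectation_le) (auto simp: own_utility_sum_le k_pos)

lemma payoff_sum_block:
  assumes "\<And>i. set_pmf (x i) \<subseteq> {1..k}"
  shows "payoff i + payoff (opponent i) = 1"
proof (rule antisym[OF payoff_sum_le])
  show "1 \<le> payoff i + payoff (opponent i)"
    unfolding payoff_sum
  proof (rule pmf_expectation_ge, simp)
    fix z assume "z \<in> set_pmf (pair_pmf (x i) (x (opponent i)))"
    then have "fst z \<le> k" "snd z \<le> k" using assms by fastforce+
    then show "1 \<le> (case z of (a, b) \<Rightarrow> own_utility k i a b + own_utility k (opponent i) b a)"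
      by (simp add: own_utility_sum_block case_prod_unfold)
  qed
qed

lemma supports_of_payoff_sum:
  assumes "payoff i + payoff (opponent i) \<ge> 1" "a \<in> set_pmf (x i)"
  shows "a \<le> k"
proof (rule ccontr)
  assume "\<not> a \<le> k"
  obtain b where "b \<in> set_pmf (x (opponent i))" using set_pmf_not_empty by fast
  with assms(2) \<open>\<not> a \<le> k\<close> have "payoff i + payoff (opponent i) < 1"
    unfolding payoff_sum
    by (intro pmf_expectation_less[where x = "(a, b)"])
      (auto simp: own_utility_sum_le own_utility_sum_less k_pos)
  with assms(1) show False by simp
qed

lemma payoff_less_1:
  assumes "k \<ge> 2" "{1..k} \<subseteq> set_pmf (x i)"
  shows "payoff i < 1"
proof -
  obtain b where b: "b \<in> set_pmf (x (opponent i))" using set_pmf_not_empty by fast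
  \<comment> \<open>Actions 1 and 2 differ in parity, so one of them fails to win against
    \<open>b\<close>. If \<open>b\<close> lies in the second block, the utility is
    \<open>- k\<close> in any case.\<close>
  obtain a where a: "a \<in> {1..k}" "\<not> wins i a b"
    using wins_one_of_two(1)[of i b] \<open>k \<ge> 2\<close>
    by (metis atLeastAtMost_iff one_le_numeral order.trans order_refl)
  have "own_utility k i a b < 1" using a by (auto simp: own_utility_def)
  with a b assms(2) show ?thesis
    unfolding expected_utility_eq
    by (intro pmf_expectation_less[where x = "(a, b)"]) (auto simp: own_utility_le_1)
qed

end

section \<open>Necessary conditions on an equilibrium\<close>

locale equilibrium =
  fixes k :: nat and x :: "nat profile"
  assumes even_k: "even k" and k_pos: "k > 0"
    and equilibrium: "strong_Nash_equilibrium (actions k) (utility k) x"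
begin

lemma k_ge_2: "k \<ge> 2"
  using even_k k_pos by (cases "k = 1") auto

lemma support: "set_pmf (x i) \<subseteq> {1..2 * k}"
  using equilibrium by (auto simp: strong_Nash_equilibrium_def mixed_strategy_def actions_def)

sublocale finite_profile k x
  by unfold_locales (auto intro: k_pos finite_subset[OF support])

lemma no_improvement:
  assumes "C \<noteq> {}" "\<And>i. i \<in> C \<Longrightarrow> set_pmf (y i) \<subseteq> {1..2 * k}"
  obtains i where "i \<in> C" "expected_utility (utility k) (override_on x y C) i \<le> payoff i"
  using equilibrium assms unfolding strong_Nash_equilibrium_def mixed_strategy_def actions_def
  by (meson linorder_not_less)

text \<open>The coalition \<open>{i}\<close> moves to a point mass: the ordinary Nash condition
  against pure replies.\<close>

lemma pure_deviation:
  assumes "a \<in> {1..2 * k}"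
  shows "measure_pmf.expectation (x (opponent i)) (own_utility k i a) \<le> payoff i"
proof -
  obtain j where "j \<in> {i}"
    "expected_utility (utility k) (override_on x (\<lambda>_. return_pmf a) {i}) j \<le> payoff j"
    by (rule no_improvement[of "{i}" "\<lambda>_. return_pmf a"]) (use assms in auto)
  moreover have "expected_utility (utility k) (override_on x (\<lambda>_. return_pmf a) {i}) i =
      measure_pmf.expectation (x (opponent i)) (own_utility k i a)"
    by (simp add: expected_utility_eq pair_return_pmf1)
  ultimately show ?thesis by simp
qed

text \<open>The reply \<open>k + r\<close> has its only negative entry against \<open>r\<close>,
  which the opponent never plays.\<close>

lemma payoff_ge_0:
  assumes r: "r \<in> {1..k}" "r \<notin> set_pmf (x (opponent i))"
  shows "payoff i \<ge> 0"
proof -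
  have "0 \<le> measure_pmf.expectation (x (opponent i)) (own_utility k i (k + r))"
    using r by (intro pmf_expectation_ge finite_support) (auto simp: own_utility_def)
  then show ?thesis using pure_deviation[of "k + r" i] r by simp
qed

text \<open>As the opponent stays in the first block, the reply \<open>k + r\<close> meets neither
  its entry \<open>- k\<close> nor its entries 0, only entries 1.\<close>

lemma payoff_ge_1:
  assumes r: "r \<in> {1..k}" "r \<notin> set_pmf (x (opponent i))" and sub: "set_pmf (x (opponent i)) \<subseteq> {1..k}"
  shows "payoff i \<ge> 1"
proof -
  have "1 \<le> measure_pmf.expectation (x (opponent i)) (own_utility k i (k + r))"
    using r sub by (intro pmf_expectation_ge finite_support) (auto simp: own_utility_def)
  then show ?thesis using pure_deviation[of "k + r" i] r by simp
qed

lemma payoff_pos: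
  assumes "set_pmf (x (opponent i)) = {1..k}"
  shows "payoff i > 0"
proof -
  obtain b where b: "b \<in> {1..k}" "wins i 1 b"
    using wins_one_of_two(2)[of i 1] k_ge_2
    by (metis atLeastAtMost_iff one_le_numeral order.trans order_refl)
  \<comment> \<open>Action 1 never earns less than 0 here and earns 1 against \<open>b\<close>,
    which has positive probability. The strict bound is an upper one, so it is applied to the
    negated utility.\<close>
  have "measure_pmf.expectation (x (opponent i)) (\<lambda>b. - own_utility k i 1 b) < 0"
    using b assms k_ge_2
    by (intro pmf_expectation_less[where x = b] finite_support) (auto simp: own_utility_def)
  then show ?thesis using pure_deviation[of 1 i] k_pos by simp
qed

lemma payoff_sum_ge_1_if_less:
  assumes "\<And>i. payoff i < 1"
  shows "payoff Agent1 + payoff Agent2 \<ge> 1"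
proof (rule ccontr)
  assume "\<not> payoff Agent1 + payoff Agent2 \<ge> 1"
  \<comment> \<open>The grand coalition will realize the split \<open>(t, 1 - t)\<close>; the outer
    bounds 0 and 1 keep \<open>t\<close> a probability.\<close>
  then have "max 0 (payoff Agent1) < min 1 (1 - payoff Agent2)"
    using assms[of Agent1] assms[of Agent2] by auto
  from dense[OF this] obtain t where t: "0 < t" "t < 1" "payoff Agent1 < t" "payoff Agent2 < 1 - t"
    by auto
  \<comment> \<open>Against column 2, row 1 pays (1, 0) and row 2 pays (0, 1), so weight
    \<open>t\<close> on row 1 yields the split.\<close>
  define p where "p = bind_pmf (bernoulli_pmf t) (\<lambda>z. return_pmf (if z then 1 else 2 :: nat))"
  define y where "y i = (case i of Agent1 \<Rightarrow> p | Agent2 \<Rightarrow> return_pmf 2)" for i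
  have E: "measure_pmf.expectation p f = t * f 1 + (1 - t) * f 2" for f :: "nat \<Rightarrow> real"
    unfolding p_def using t by (subst pmf_expectation_bind[of UNIV]) (auto simp: UNIV_bool)
  have 1: "expected_utility (utility k) y Agent1 = t"
    using k_ge_2 by (simp add: expected_utility_eq y_def pair_return_pmf2 E own_utility_def)
  have 2: "expected_utility (utility k) y Agent2 = 1 - t"
    using k_ge_2 by (simp add: expected_utility_eq y_def pair_return_pmf1 E own_utility_def)
  obtain i where "expected_utility (utility k) (override_on x y UNIV) i \<le> payoff i"
    by (rule no_improvement[of UNIV y]) (use k_ge_2 in \<open>auto simp: y_def p_def split: agent.splits if_splits\<close>)
  moreover have "override_on x y UNIV = y" by (auto simp: override_on_def)
  ultimately show False using 1 2 t by (cases i) auto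
qed

text \<open>A payoff of at least 1 cannot be raised by the grand coalition; then it suffices that
  the other payoff is nonnegative.\<close>

lemma payoff_sum_ge_1: "payoff i + payoff (opponent i) \<ge> 1"
proof (cases "\<forall>j. payoff j < 1")
  case True
  then show ?thesis using payoff_sum_ge_1_if_less by (cases i) (auto simp: add.commute)
next
  case False
  then obtain j where j: "payoff j \<ge> 1" by (auto simp: not_less)
  then have "\<not> {1..k} \<subseteq> set_pmf (x j)" using payoff_less_1[of j] k_ge_2 by auto
  then have "payoff (opponent j) \<ge> 0" using payoff_ge_0[of _ "opponent j"] by (metis opponent_opponent subsetI)
  then show ?thesis using j agent_cases_opponent[of j i] by auto
qed

lemma support_block: "set_pmf (x i) \<subseteq> {1..k}"
  using support[of i] supports_of_payoff_sum[OF payoff_sum_ge_1, of _ i] by fastforce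

lemma support_eq: "set_pmf (x i) = {1..k}"
proof (rule ccontr)
  assume "set_pmf (x i) \<noteq> {1..k}"
  then obtain r where "r \<in> {1..k}" "r \<notin> set_pmf (x i)" using support_block[of i] by blast
  then have "payoff (opponent i) \<ge> 1" using payoff_ge_1[of r "opponent i"] support_block by simp
  then have "payoff i \<le> 0" using payoff_sum_le[of i] by simp
  \<comment> \<open>An action missed by the opponent too would give \<open>i\<close> a payoff of at
    least 1.\<close>
  then have "r \<in> set_pmf (x (opponent i))" if "r \<in> {1..k}" for r
    using payoff_ge_1[OF that _ support_block, of i] by argo
  then have "set_pmf (x (opponent i)) = {1..k}" using support_block by blast
  then have "payoff i > 0" by (rule payoff_pos)
  with \<open>payoff i \<le> 0\<close> show False by simp
qed

end

section \<open>Uniform play on the first block is an equilibrium\<close>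

lemma expected_utility_uniform_le:
  assumes "even k" "k > 0" "set_pmf (x i) \<subseteq> {1..2 * k}" "x (opponent i) = pmf_of_set {1..k}"
  shows "expected_utility (utility k) x i \<le> 1 / 2"
proof -
  have fin: "finite (set_pmf (x i))" using assms(3) finite_subset by blast
  \<comment> \<open>Conditioning on the agent's own action turns a mixed reply into an average of
    pure ones.\<close>
  have "expected_utility (utility k) x i = (\<Sum>a\<in>set_pmf (x i).
      pmf (x i) a *\<^sub>R measure_pmf.expectation (pmf_of_set {1..k}) (own_utility k i a))"
    unfolding expected_utility_eq assms(4) pair_pmf_def
    using fin \<open>k > 0\<close>
    by (subst pmf_expectation_bind[OF fin]) (auto simp: set_pmf_of_set simp flip: map_pmf_def)
  also have "\<dots> \<le> (\<Sum>a\<in>set_pmf (x i). pmf (x i) a *\<^sub>R (1 / 2))"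
    using assms by (intro sum_mono scaleR_left_mono own_utility_uniform_le) auto
  also have "\<dots> = 1 / 2"
    using sum_pmf_eq_1[OF fin order_refl] by (simp flip: sum_divide_distrib)
  finally show ?thesis .
qed

lemma uniform_equilibrium:
  assumes "even k" "k > 0"
  shows "strong_Nash_equilibrium (actions k) (utility k) (\<lambda>_. pmf_of_set {1..k})"
proof -
  let ?x = "\<lambda>_. pmf_of_set {1..k} :: nat pmf"
  have supp: "set_pmf (?x i) = {1..k}" for i :: agent using \<open>k > 0\<close> by (intro set_pmf_of_set) auto
  interpret finite_profile k ?x by unfold_locales (use \<open>k > 0\<close> supp in auto)
  have half: "payoff i = 1 / 2" for i
  proof -
    have le: "payoff j \<le> 1 / 2" for j
      by (rule expected_utility_uniform_le) (use assms supp in auto)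
    \<comment> \<open>Two payoffs of at most 1/2 that sum to 1 are both 1/2.\<close>
    show ?thesis using payoff_sum_block[of i] le[of i] le[of "opponent i"] supp by simp
  qed
  have False if C: "C \<noteq> {}" "\<And>i. i \<in> C \<Longrightarrow> set_pmf (y i) \<subseteq> {1..2 * k}"
      "\<And>i. i \<in> C \<Longrightarrow> expected_utility (utility k) (override_on ?x y C) i > 1 / 2" for C y
  proof -
    let ?z = "override_on ?x y C"
    have suppz: "set_pmf (?z j) \<subseteq> {1..2 * k}" for j
      using C(2) supp by (cases "j \<in> C") auto
    interpret z: finite_profile k ?z
      by unfold_locales (rule k_pos, rule finite_subset[OF suppz], simp)
    obtain i where i: "i \<in> C" using C by blast
    show False
    \<comment> \<open>Two improving agents would total more than 1; a lone deviator still faces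
      uniform play.\<close>
    proof (cases "opponent i \<in> C")
      case True
      then show False using z.payoff_sum_le[of i] C(3)[OF i] C(3)[OF True] by simp
    next
      case False
      then have "expected_utility (utility k) ?z i \<le> 1 / 2"
        using assms suppz by (intro expected_utility_uniform_le) auto
      then show False using C(3)[OF i] by simp
    qed
  qed
  moreover have "mixed_strategy (actions k) i (?x i)" for i
    unfolding mixed_strategy_def actions_def supp by auto
  ultimately show ?thesis
    unfolding strong_Nash_equilibrium_def mixed_strategy_def actions_def half by blast
qed

theorem corollary4p1:
  fixes k :: nat
  assumes "even k" and "k > 0"
  shows "\<exists>x. strong_Nash_equilibrium (actions k) (utility k) x \<and>
             card (set_pmf (x Agent1)) = k \<and> card (set_pmf (x Agent2)) = k \<and>
             (\<forall>y. strong_Nash_equilibrium (actions k) (utility k) y \<longrightarrow>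
                  set_pmf (y Agent1) = set_pmf (x Agent1) \<and>
                  set_pmf (y Agent2) = set_pmf (x Agent2))"
proof -
  have "set_pmf (y i) = {1..k}" if "strong_Nash_equilibrium (actions k) (utility k) y" for y i
    using equilibrium.support_eq[of k y] assms that by (simp add: equilibrium_def)
  with uniform_equilibrium[OF assms] show ?thesis
    by (intro exI[of _ "\<lambda>_. pmf_of_set {1..k}"]) (use \<open>k > 0\<close> in \<open>simp add: set_pmf_of_set\<close>)
qed

end
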